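(* Let $a\ge 2$ be a natural number and let $b$ be a natural number satisfying $3 \le b \le 2a - 1$. Then there is a graph $G$ such that $\gamma_s(G) = a$ and $\gamma_s(\mu(G))=b$.
   Context: All graphs are finite, simple, connected, undirected, with nonempty vertex set (in particular the graph $G$ in the claim is connected). A set $S\subseteq V(G)$ is a dominating set of $G$ if every vertex of $V(G)\setminus S$ is adjacent to some vertex of $S$. A dominating set $S$ is a secure dominating set of $G$ if for every $u\in V(G)\setminus S$ there is $v\in S$ adjacent to $u$ such that $(S\setminus\{v\})\cup\{u\}$ is a dominating set of $G$. The secure domination number $\gamma_s(G)$ is the minimum cardinality of a secure dominating set of $G$. For a graph $G$ with vertices $v_1,\dots,v_n$, the Mycielskian $\mu(G)$ is the graph with vertex set $\{v_1,\dots,v_n,u_1,\dots,u_n,w\}$ ($2n+1$ distinct vertices) whose edges are: all edges of $G$; the edges $wu_i$ for $1\le i\le n$; and, for each edge $v_iv_j$ of $G$, the edges $u_iv_j$ and $v_iu_j$. *)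

theory Defs
  imports "Graph_Theory.Graph_Theory"
begin

text \<open>
  A finite simple undirected graph is a \<^locale>\<open>pair_graph\<close>: every undirected edge is represented
  by the two arcs \<open>(x, y)\<close> and \<open>(y, x)\<close>, and there are no loops.
\<close>

definition dominating_set :: "'a pair_pre_digraph \<Rightarrow> 'a set \<Rightarrow> bool" where
  "dominating_set G S \<longleftrightarrow>
     S \<subseteq> pverts G \<and> (\<forall>u \<in> pverts G - S. \<exists>v \<in> S. (u, v) \<in> parcs G)"

definition secure_dominating_set :: "'a pair_pre_digraph \<Rightarrow> 'a set \<Rightarrow> bool" where
  "secure_dominating_set G S \<longleftrightarrow>
     dominating_set G S \<and>
     (\<forall>u \<in> pverts G - S. \<exists>v \<in> S. (u, v) \<in> parcs G \<and> dominating_set G ((S - {v}) \<union> {u}))"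

definition secure_domination_number :: "'a pair_pre_digraph \<Rightarrow> nat" where
  "secure_domination_number G = (LEAST k. \<exists>S. secure_dominating_set G S \<and> card S = k)"

text \<open>
  The vertices of the Mycielskian: \<open>Orig v\<^sub>i\<close> stands for the vertex \<open>v\<^sub>i\<close> of the original graph,
  \<open>Copy v\<^sub>i\<close> for its twin \<open>u\<^sub>i\<close>, and \<open>Apex\<close> for \<open>w\<close>.
\<close>

datatype 'a myc_vertex = Orig 'a | Copy 'a | Apex

text \<open>
  Since \<open>parcs G\<close> contains both orientations of each edge \<open>v\<^sub>i v\<^sub>j\<close>, the second and third
  sets below together contain both orientations of the edges \<open>u\<^sub>i v\<^sub>j\<close> and \<open>v\<^sub>i u\<^sub>j\<close>.
\<close>

definition mycielskian :: "'a pair_pre_digraph \<Rightarrow> 'a myc_vertex pair_pre_digraph" where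
  "mycielskian G =
     \<lparr> pverts = Orig ` pverts G \<union> Copy ` pverts G \<union> {Apex},
       parcs = {(Orig x, Orig y) | x y. (x, y) \<in> parcs G}
             \<union> {(Copy x, Orig y) | x y. (x, y) \<in> parcs G}
             \<union> {(Orig x, Copy y) | x y. (x, y) \<in> parcs G}
             \<union> {(Apex, Copy x) | x. x \<in> pverts G}
             \<union> {(Copy x, Apex) | x. x \<in> pverts G} \<rparr>"

lemma pair_graph_mycielskian:
  assumes "pair_graph G"
  shows "pair_graph (mycielskian G)"
proof -
  interpret G: pair_graph G by fact
  have sub': "x \<in> pverts (mycielskian G) \<and> y \<in> pverts (mycielskian G)"
    if "(x, y) \<in> parcs (mycielskian G)" for x y
    using that by (auto simp: mycielskian_def dest: G.in_arcsD1 G.in_arcsD2)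
  have sub: "fst e \<in> pverts (mycielskian G) \<and> snd e \<in> pverts (mycielskian G)"
    if "e \<in> parcs (mycielskian G)" for e
    using sub'[of "fst e" "snd e"] that by simp
  have fin: "finite (pverts (mycielskian G))"
    by (simp add: mycielskian_def G.pair_finite_verts)
  have "parcs (mycielskian G) \<subseteq> pverts (mycielskian G) \<times> pverts (mycielskian G)"
    by (intro subsetI, unfold mem_Times_iff, rule sub)
  then have fin_arcs: "finite (parcs (mycielskian G))"
    by (rule finite_subset) (intro finite_cartesian_product fin)
  have sym: "(y, x) \<in> parcs (mycielskian G)" if "(x, y) \<in> parcs (mycielskian G)" for x y
    using that by (auto simp: mycielskian_def dest: G.arcs_symmetric)
  have loopfree': "x \<noteq> y" if "(x, y) \<in> parcs (mycielskian G)" for x y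
    using that by (auto simp: mycielskian_def dest: G.no_loops')
  have loopfree: "fst e \<noteq> snd e" if "e \<in> parcs (mycielskian G)" for e
    using loopfree'[of "fst e" "snd e"] that by simp
  show ?thesis
    unfolding pair_graph_def pair_digraph_def pair_pseudo_graph_def pair_fin_digraph_def
      pair_fin_digraph_axioms_def pair_loopfree_digraph_def pair_loopfree_digraph_axioms_def
      pair_sym_digraph_def pair_sym_digraph_axioms_def pair_wf_digraph_def
      symmetric_def with_proj_simps
    using sub fin fin_arcs loopfree by (simp add: symI sym)
qed

text \<open>The minimum in the secure domination number is attained.\<close>

lemma secure_domination_number_attained:
  "\<exists>S. secure_dominating_set G S \<and> card S = secure_domination_number G"
proof -
  have "secure_dominating_set G (pverts G)"
    by (simp add: secure_dominating_set_def dominating_set_def)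
  then have "\<exists>k S. secure_dominating_set G S \<and> card S = k"
    by blast
  then show ?thesis
    unfolding secure_domination_number_def by (rule LeastI_ex)
qed

end

theory Submission
  imports Defs "HOL-Library.Countable"
begin

text \<open>
  Write \<open>\<gamma>\<^sub>s\<close> for the secure domination number and \<open>\<mu>\<close> for the Mycielskian. Two families of
  trees realise all pairs. In both, a hub is joined to \<open>q\<close> spokes, and \<open>m\<close> pendant edges (a knee
  and a foot) hang below: every knee is joined to the hub in the first family, and to a spoke in
  the second.

  In the first family the spokes are leaves, and there are at least two. The star formed by the hub
  and the spokes costs \<open>q\<close> guards and every pendant edge costs one, so \<open>\<gamma>\<^sub>s = q + m\<close>. In the
  Mycielskian the \<open>q\<close> leaves become cheap: the hub, its twin and the apex together defend any
  number of leaves and twins of leaves. Every pendant edge still costs one, which gives \<open>3 + m\<close>.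
  Hence \<open>m\<close> and \<open>q\<close> can be chosen to produce every \<open>b\<close> from \<open>3\<close> to \<open>a + 1\<close>.

  In the second family every spoke bears at least one knee, and \<open>\<gamma>\<^sub>s = 1 + m\<close> with guards on the
  hub and the knees. In the Mycielskian the apex is the natural guard for the twins, but it may
  step down only if every other twin is guarded or sees a guarded original vertex. If no twin is
  guarded, the guards in \<open>G\<close> should form a total dominating set, such as all spokes and knees.
  Other arrangements are no cheaper: attacks on the twins of a knee and its foot force one
  more guard for every spoke, and \<open>\<gamma>\<^sub>s(\<mu>) = 1 + q + m\<close>. With \<open>m = a - 1\<close> and \<open>1 \<le> q \<le> m\<close> this covers every \<open>b\<close> from
  \<open>a + 1\<close> to \<open>2a - 1\<close>.

  The upper bounds for Mycielskians come from one criterion on total domination,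
  \<open>secure_dominating_set_mycielskianI\<close>. The lower bounds count guards leg by leg: the vertices are
  partitioned into the pendant edges, possibly with a spoke each, and a core around the hub, and
  attacks on a few vertices of one part bound the guards in it from below
  (\<open>short_limbs.card_mycielskian_ge\<close>, \<open>long_limbs.card_leg_ge\<close>).
\<close>

section \<open>Domination\<close>

lemma dominating_setE:
  assumes "dominating_set G S" and "u \<in> pverts G"
  obtains v where "v \<in> S" and "v = u \<or> (u, v) \<in> parcs G"
  using assms by (auto simp: dominating_set_def)

lemma secure_dominating_setE:
  assumes "secure_dominating_set G S" and "u \<in> pverts G" and "u \<notin> S"
  obtains v where "v \<in> S" and "(u, v) \<in> parcs G" and "dominating_set G (insert u (S - {v}))"
  using assms by (auto simp: secure_dominating_set_def)

lemma secure_domination_number_eqI: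
  assumes "secure_dominating_set G S" and "card S = k"
    and "\<And>T. secure_dominating_set G T \<Longrightarrow> k \<le> card T"
  shows "secure_domination_number G = k"
  unfolding secure_domination_number_def
  by (rule Least_equality) (use assms in auto)

lemma secure_dominating_set_subset: "secure_dominating_set G S \<Longrightarrow> S \<subseteq> pverts G"
  by (simp add: secure_dominating_set_def dominating_set_def)

lemma sum_card_fibres_le:
  assumes "finite S" and "finite I"
  shows "(\<Sum>x\<in>I. card {v \<in> S. f v = x}) \<le> card S"
proof -
  have "(\<Sum>x\<in>I. card {v \<in> S. f v = x}) = card (\<Union>x\<in>I. {v \<in> S. f v = x})"
    by (rule card_UN_disjoint [symmetric]) (use assms in auto)
  also have "\<dots> \<le> card S"
    by (rule card_mono) (use assms in auto)
  finally show ?thesis .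
qed

section \<open>Relabelling the vertices\<close>

text \<open>
  The trees below are built on a datatype of named vertices. Secure domination numbers do not
  depend on the names, so the trees can be moved to the natural numbers afterwards.
\<close>

definition relabel :: "('a \<Rightarrow> 'b) \<Rightarrow> 'a pair_pre_digraph \<Rightarrow> 'b pair_pre_digraph" where
  "relabel f G = \<lparr> pverts = f ` pverts G, parcs = map_prod f f ` parcs G \<rparr>"

lemma dominating_set_relabel:
  assumes "inj f"
  shows "dominating_set (relabel f G) (f ` S) \<longleftrightarrow> dominating_set G S"
proof -
  have "(f u, f v) \<in> parcs (relabel f G) \<longleftrightarrow> (u, v) \<in> parcs G" for u v
    using assms by (auto simp: relabel_def dest: injD)
  moreover have "pverts (relabel f G) - f ` S = f ` (pverts G - S)"
    using assms by (simp add: relabel_def image_set_diff)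
  moreover have "f ` S \<subseteq> pverts (relabel f G) \<longleftrightarrow> S \<subseteq> pverts G"
    using assms by (simp add: relabel_def inj_image_subset_iff)
  ultimately show ?thesis
    by (simp add: dominating_set_def)
qed

lemma secure_dominating_set_relabel:
  assumes "inj f"
  shows "secure_dominating_set (relabel f G) (f ` S) \<longleftrightarrow> secure_dominating_set G S"
proof -
  have "(f u, f v) \<in> parcs (relabel f G) \<longleftrightarrow> (u, v) \<in> parcs G" for u v
    using assms by (auto simp: relabel_def dest: injD)
  moreover have "pverts (relabel f G) - f ` S = f ` (pverts G - S)"
    using assms by (simp add: relabel_def image_set_diff)
  moreover have "f ` S - {f v} \<union> {f u} = f ` (S - {v} \<union> {u})" for u v
    using assms by (simp add: image_Un image_set_diff)
  ultimately show ?thesis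
    by (simp only: secure_dominating_set_def dominating_set_relabel [OF assms] ball_simps bex_simps)
qed

lemma secure_domination_number_relabel:
  assumes "inj f"
  shows "secure_domination_number (relabel f G) = secure_domination_number G"
proof -
  have "(\<exists>T. secure_dominating_set (relabel f G) T \<and> card T = k) \<longleftrightarrow>
        (\<exists>S. secure_dominating_set G S \<and> card S = k)" (is "?L \<longleftrightarrow> ?R") for k
  proof
    assume ?L
    then obtain T where T: "secure_dominating_set (relabel f G) T" "card T = k"
      by blast
    then have "T \<subseteq> f ` pverts G"
      using secure_dominating_set_subset [OF T(1)] by (simp add: relabel_def)
    then obtain S where "T = f ` S"
      by (auto simp: subset_image_iff)
    with T assms show ?R
      by (auto simp: secure_dominating_set_relabel card_image inj_on_subset)
  next
    assume ?R
    with assms show ?L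
      by (metis secure_dominating_set_relabel card_image inj_on_subset subset_UNIV)
  qed
  then show ?thesis
    by (simp add: secure_domination_number_def)
qed

lemma parcs_mycielskian:
  "parcs (mycielskian G) =
    map_prod Orig Orig ` parcs G \<union> map_prod Copy Orig ` parcs G \<union> map_prod Orig Copy ` parcs G
    \<union> (\<lambda>x. (Apex, Copy x)) ` pverts G \<union> (\<lambda>x. (Copy x, Apex)) ` pverts G"
  unfolding mycielskian_def by force

lemma mycielskian_relabel:
  "mycielskian (relabel f G) = relabel (map_myc_vertex f) (mycielskian G)"
proof -
  have "parcs (mycielskian (relabel f G)) = parcs (relabel (map_myc_vertex f) (mycielskian G))"
    unfolding parcs_mycielskian relabel_def
    by (simp add: image_Un image_image map_prod_def split_beta parcs_mycielskian)
  moreover have "pverts (mycielskian (relabel f G)) = pverts (relabel (map_myc_vertex f) (mycielskian G))"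
    by (simp add: mycielskian_def relabel_def image_Un image_image)
  ultimately show ?thesis
    by (cases "mycielskian (relabel f G)"; cases "relabel (map_myc_vertex f) (mycielskian G)") simp
qed

lemma secure_domination_number_mycielskian_relabel:
  assumes "inj f"
  shows "secure_domination_number (mycielskian (relabel f G)) =
    secure_domination_number (mycielskian G)"
  using assms
  by (simp add: mycielskian_relabel secure_domination_number_relabel myc_vertex.inj_map)

lemma pair_graph_relabel:
  assumes "pair_graph G" and "inj f"
  shows "pair_graph (relabel f G)"
proof -
  interpret G: pair_graph G by fact
  have "(f y, f x) \<in> map_prod f f ` parcs G" if "(x, y) \<in> parcs G" for x y
    using G.arcs_symmetric [OF that] by auto
  moreover have "f x \<noteq> f y" if "(x, y) \<in> parcs G" for x y
    using G.no_loops' [OF that] assms(2) by (simp add: inj_eq)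
  ultimately show ?thesis
    using G.pair_finite_verts G.pair_finite_arcs
    by unfold_locales
      (auto simp: relabel_def symmetric_def intro!: symI dest: G.in_arcsD1 G.in_arcsD2)
qed

text \<open>
  Connectedness is defined through the symmetric closure of the arcs. For a symmetric graph it is
  enough to follow arcs towards one root, which suits trees.
\<close>

lemma connected_if_reaches_root:
  assumes "pair_graph G" and "r \<in> pverts G" and "\<And>v. v \<in> pverts G \<Longrightarrow> (v, r) \<in> (parcs G)\<^sup>*"
  shows "connected (with_proj G)"
proof -
  interpret G: pair_graph G by fact
  have "sym (parcs G)"
    by (auto intro: symI G.arcs_symmetric)
  then have "sym ((parcs G)\<^sup>*)"
    by (rule sym_rtrancl)
  have "u \<rightarrow>\<^sup>*\<^bsub>mk_symmetric (with_proj G)\<^esub> v" if "u \<in> pverts G" "v \<in> pverts G" for u v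
  proof -
    have "(u, v) \<in> (parcs G)\<^sup>*"
      using \<open>sym ((parcs G)\<^sup>*)\<close> assms(3) that by (meson rtrancl_trans symD)
    then have "u \<rightarrow>\<^sup>*\<^bsub>with_proj G\<^esub> v"
      using that(1) by (induction rule: rtrancl_induct) (auto intro: G.reachable_adj_trans)
    then show ?thesis
      by (rule G.reachable_mk_symmetricI)
  qed
  then show ?thesis
    using assms(2) by (auto simp: connected_def strongly_connected_def)
qed

lemma connected_relabel_if_reaches_root:
  assumes "pair_graph G" and "inj f" and "r \<in> pverts G"
    and "\<And>v. v \<in> pverts G \<Longrightarrow> (v, r) \<in> (parcs G)\<^sup>*"
  shows "connected (with_proj (relabel f G))"
proof (rule connected_if_reaches_root)
  show "pair_graph (relabel f G)"
    using assms by (simp add: pair_graph_relabel)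
  show "f r \<in> pverts (relabel f G)"
    using assms by (simp add: relabel_def)
  fix v assume "v \<in> pverts (relabel f G)"
  then obtain u where u: "u \<in> pverts G" "v = f u"
    by (auto simp: relabel_def)
  have "(f u, f r) \<in> (parcs (relabel f G))\<^sup>*"
    using assms(4)[OF u(1)]
    by (induction rule: rtrancl_induct) (auto simp: relabel_def intro: rtrancl_into_rtrancl)
  with u show "(v, f r) \<in> (parcs (relabel f G))\<^sup>*" by simp
qed

section \<open>Mycielskians\<close>

lemma pverts_mycielskian:
  "pverts (mycielskian G) = Orig ` pverts G \<union> Copy ` pverts G \<union> {Apex}"
  by (simp add: mycielskian_def)

lemma neighbours_Orig:
  "(Orig u, x) \<in> parcs (mycielskian G) \<longleftrightarrow> (\<exists>v. (u, v) \<in> parcs G \<and> (x = Orig v \<or> x = Copy v))"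
  by (auto simp: mycielskian_def)

lemma neighbours_Copy:
  "(Copy u, x) \<in> parcs (mycielskian G) \<longleftrightarrow>
    (\<exists>v. (u, v) \<in> parcs G \<and> x = Orig v) \<or> (u \<in> pverts G \<and> x = Apex)"
  by (auto simp: mycielskian_def)

lemma neighbours_Apex:
  "(Apex, x) \<in> parcs (mycielskian G) \<longleftrightarrow> (\<exists>v\<in>pverts G. x = Copy v)"
  by (auto simp: mycielskian_def)

lemmas neighbours_mycielskian = neighbours_Orig neighbours_Copy neighbours_Apex

text \<open>
  With the apex guarded, every copy is dominated, so a guard moving from an original vertex or
  from a copy to an original vertex only has to keep \<open>G\<close> dominated; moving off a copy is harmless
  because \<open>D\<close> alone dominates \<open>G\<close>. An attack on a copy is met by the apex. The other copies are
  then on their own, and they survive because each of them is guarded itself (those of \<open>E\<close>) or sees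
  an original neighbour in \<open>D\<close>: this is where \<open>D\<close> must dominate totally outside \<open>E\<close>.
\<close>

lemma secure_dominating_set_mycielskianI:
  assumes E: "E \<subseteq> pverts G"
    and domD: "dominating_set G D"
    and total: "\<And>u. u \<in> pverts G - E \<Longrightarrow> \<exists>v\<in>D. (u, v) \<in> parcs G"
    and guard: "\<And>u. u \<in> pverts G - D \<Longrightarrow>
      (\<exists>v\<in>D. (u, v) \<in> parcs G \<and> dominating_set G (insert u (D - {v}))) \<or>
      (\<exists>v\<in>E. (u, v) \<in> parcs G)"
  shows "secure_dominating_set (mycielskian G) (insert Apex (Orig ` D \<union> Copy ` E))"
proof -
  let ?M = "mycielskian G" and ?T = "insert Apex (Orig ` D \<union> Copy ` E)"
  have D: "D \<subseteq> pverts G"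
    using domD by (simp add: dominating_set_def)
  have sub: "?T \<subseteq> pverts ?M"
    using D E by (auto simp: pverts_mycielskian)
  have dominated_Orig: "\<exists>v\<in>S. (Orig x, v) \<in> parcs ?M"
    if x: "x \<in> pverts G" "Orig x \<notin> S" and F: "Orig ` F \<subseteq> S" "dominating_set G F" for x F S
  proof -
    obtain v where "v \<in> F" "v = x \<or> (x, v) \<in> parcs G"
      using F(2) x(1) by (rule dominating_setE)
    with x F have "Orig v \<in> S" "(x, v) \<in> parcs G"
      by auto
    then show ?thesis
      by (intro bexI [of _ "Orig v"]) (auto simp: neighbours_Orig)
  qed
  have dom_with_Apex: "dominating_set ?M S"
    if S: "S \<subseteq> pverts ?M" "Apex \<in> S" and F: "Orig ` F \<subseteq> S" "dominating_set G F" for S F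
  proof -
    have "\<exists>v\<in>S. (u, v) \<in> parcs ?M" if u: "u \<in> pverts ?M - S" for u
    proof (cases u)
      case (Orig x)
      with u show ?thesis
        by (auto simp: pverts_mycielskian intro!: dominated_Orig [OF _ _ F])
    next
      case (Copy x)
      with u S show ?thesis
        by (intro bexI [of _ Apex]) (auto simp: neighbours_Copy pverts_mycielskian)
    next
      case Apex
      with u S show ?thesis by simp
    qed
    with S show ?thesis by (simp add: dominating_set_def)
  qed
  have "\<exists>v\<in>?T. (u, v) \<in> parcs ?M \<and> dominating_set ?M (insert u (?T - {v}))"
    if u: "u \<in> pverts ?M - ?T" for u
  proof (cases u)
    case (Orig x)
    with u have "x \<in> pverts G - D"
      by (auto simp: pverts_mycielskian)
    with guard consider v where "v \<in> D" "(x, v) \<in> parcs G" "dominating_set G (insert x (D - {v}))"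
      | v where "v \<in> E" "(x, v) \<in> parcs G"
      by blast
    then show ?thesis
    proof cases
      case 1
      have "dominating_set ?M (insert u (?T - {Orig v}))"
        by (rule dom_with_Apex [OF _ _ _ 1(3)]) (use u sub Orig in auto)
      with 1 Orig show ?thesis
        by (intro bexI [of _ "Orig v"]) (auto simp: neighbours_Orig)
    next
      case 2
      have "dominating_set ?M (insert u (?T - {Copy v}))"
        by (rule dom_with_Apex [OF _ _ _ domD]) (use u sub Orig in auto)
      with 2 Orig show ?thesis
        by (intro bexI [of _ "Copy v"]) (auto simp: neighbours_Orig)
    qed
  next
    case (Copy x)
    with u have x: "x \<in> pverts G"
      by (auto simp: pverts_mycielskian)
    let ?T' = "insert u (?T - {Apex})"
    have "\<exists>v\<in>?T'. (y, v) \<in> parcs ?M" if y: "y \<in> pverts ?M - ?T'" for y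
    proof (cases y)
      case (Orig z)
      with y show ?thesis
        by (auto simp: pverts_mycielskian intro!: dominated_Orig [OF _ _ _ domD])
    next
      case (Copy z)
      with y have "z \<in> pverts G - E"
        by (auto simp: pverts_mycielskian)
      then obtain v where "v \<in> D" "(z, v) \<in> parcs G"
        using total by blast
      with Copy show ?thesis
        by (intro bexI [of _ "Orig v"]) (auto simp: neighbours_Copy)
    next
      case Apex
      with Copy x show ?thesis
        by (intro bexI [of _ u]) (auto simp: neighbours_Apex)
    qed
    then have "dominating_set ?M ?T'"
      using u sub by (auto simp: dominating_set_def)
    with x Copy show ?thesis
      by (intro bexI [of _ Apex]) (auto simp: neighbours_Copy)
  next
    case Apex
    with u show ?thesis by simp
  qed
  moreover have "dominating_set ?M ?T"
    by (rule dom_with_Apex [OF sub _ _ domD]) auto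
  ultimately show ?thesis
    by (simp add: secure_dominating_set_def)
qed

lemma card_insert_Apex:
  assumes "finite D" and "finite E"
  shows "card (insert Apex (Orig ` D \<union> Copy ` E)) = card D + card E + 1"
proof -
  have "card (Orig ` D \<union> Copy ` E) = card D + card E"
    using assms by (subst card_Un_disjoint) (auto simp: card_image inj_on_def)
  moreover have "Apex \<notin> Orig ` D \<union> Copy ` E"
    by auto
  ultimately show ?thesis
    using assms by simp
qed

section \<open>Limb trees\<close>

datatype node = Hub | Spoke nat | Knee nat | Foot nat

instance node :: countable
  by countable_datatype

text \<open>
  The parameter \<open>par\<close> tells at which vertex the pendant edge from \<open>Knee j\<close> to \<open>Foot j\<close> is attached.
  Each edge is listed once here, directed away from the hub.
\<close>

definition limb_tree_arcs :: "nat \<Rightarrow> nat \<Rightarrow> (nat \<Rightarrow> node) \<Rightarrow> node rel" where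
  "limb_tree_arcs q m par =
     {(Hub, Spoke i) | i. i < q} \<union> {(par j, Knee j) | j. j < m} \<union> {(Knee j, Foot j) | j. j < m}"

definition limb_tree :: "nat \<Rightarrow> nat \<Rightarrow> (nat \<Rightarrow> node) \<Rightarrow> node pair_pre_digraph" where
  "limb_tree q m par =
     \<lparr> pverts = {Hub} \<union> Spoke ` {..<q} \<union> Knee ` {..<m} \<union> Foot ` {..<m},
       parcs = limb_tree_arcs q m par \<union> (limb_tree_arcs q m par)\<inverse> \<rparr>"

lemma pverts_limb_tree:
  "pverts (limb_tree q m par) = {Hub} \<union> Spoke ` {..<q} \<union> Knee ` {..<m} \<union> Foot ` {..<m}"
  by (simp add: limb_tree_def)

locale limb_tree_graph =
  fixes q m :: nat and par :: "nat \<Rightarrow> node"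
  assumes par: "j < m \<Longrightarrow> par j \<in> insert Hub (Spoke ` {..<q})"
begin

abbreviation G :: "node pair_pre_digraph" where
  "G \<equiv> limb_tree q m par"

lemma par_neq:
  assumes "j < m"
  shows "par j \<noteq> Knee k" and "Knee k \<noteq> par j" and "par j \<noteq> Foot k" and "Foot k \<noteq> par j"
  using par [OF assms] by auto

lemma neighbours_Hub:
  "(Hub, x) \<in> parcs G \<longleftrightarrow> (\<exists>i<q. x = Spoke i) \<or> (\<exists>j<m. par j = Hub \<and> x = Knee j)"
  by (auto simp: limb_tree_def limb_tree_arcs_def)

lemma neighbours_Spoke:
  "(Spoke i, x) \<in> parcs G \<longleftrightarrow> i < q \<and> x = Hub \<or> (\<exists>j<m. par j = Spoke i \<and> x = Knee j)"
  by (auto simp: limb_tree_def limb_tree_arcs_def)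

lemma neighbours_Knee:
  "(Knee j, x) \<in> parcs G \<longleftrightarrow> j < m \<and> (x = Foot j \<or> x = par j)"
  by (auto simp: limb_tree_def limb_tree_arcs_def par_neq)

lemma neighbours_Foot:
  "(Foot j, x) \<in> parcs G \<longleftrightarrow> j < m \<and> x = Knee j"
  by (auto simp: limb_tree_def limb_tree_arcs_def par_neq)

lemmas neighbours = neighbours_Hub neighbours_Spoke neighbours_Knee neighbours_Foot

lemma finite_secure_dominating_set:
  "secure_dominating_set G S \<Longrightarrow> finite S"
  "secure_dominating_set (mycielskian G) T \<Longrightarrow> finite T"
  by (auto dest!: secure_dominating_set_subset elim!: finite_subset simp: pverts_mycielskian pverts_limb_tree)

lemma pair_graph_limb_tree: "pair_graph G"
proof -
  have sub: "parcs G \<subseteq> pverts G \<times> pverts G"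
    using par by (auto simp: limb_tree_def limb_tree_arcs_def)
  have fin: "finite (pverts G)"
    by (simp add: pverts_limb_tree)
  have finarcs: "finite (parcs G)"
    using sub fin by (meson finite_SigmaI finite_subset)
  have loop: "x \<noteq> y" if "(x, y) \<in> parcs G" for x y
    using that by (auto simp: limb_tree_def limb_tree_arcs_def par_neq)
  have sym: "sym (parcs G)"
    by (auto simp: limb_tree_def intro: symI)
  show ?thesis
    by unfold_locales (use sub fin finarcs loop sym in \<open>auto simp: symmetric_def\<close>)
qed

lemma reaches_Hub:
  assumes "v \<in> pverts G"
  shows "(v, Hub) \<in> (parcs G)\<^sup>*"
proof -
  have spoke: "(Spoke i, Hub) \<in> (parcs G)\<^sup>*" if "i < q" for i
    using that by (intro r_into_rtrancl) (simp add: neighbours)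
  have knee: "(Knee j, Hub) \<in> (parcs G)\<^sup>*" if "j < m" for j
  proof -
    have "(Knee j, par j) \<in> parcs G"
      using that by (simp add: neighbours)
    moreover have "(par j, Hub) \<in> (parcs G)\<^sup>*"
      using par [OF that] spoke by auto
    ultimately show ?thesis by (rule converse_rtrancl_into_rtrancl)
  qed
  have foot: "(Foot j, Hub) \<in> (parcs G)\<^sup>*" if "j < m" for j
  proof -
    have "(Foot j, Knee j) \<in> parcs G"
      using that by (simp add: neighbours)
    then show ?thesis using knee [OF that] by (rule converse_rtrancl_into_rtrancl)
  qed
  show ?thesis
    using assms spoke knee foot by (auto simp: pverts_limb_tree)
qed

text \<open>
  Any injection of the vertices into the natural numbers turns the tree into a witness of the
  required type.
\<close>

lemma nat_copy:
  assumes "secure_domination_number G = a" and "secure_domination_number (mycielskian G) = b"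
  shows "\<exists>H :: nat pair_pre_digraph. pair_graph H \<and> connected (with_proj H) \<and>
    secure_domination_number H = a \<and> secure_domination_number (mycielskian H) = b"
proof (intro exI conjI)
  let ?H = "relabel (to_nat :: node \<Rightarrow> nat) G"
  show "pair_graph ?H"
    by (rule pair_graph_relabel [OF pair_graph_limb_tree inj_to_nat])
  show "connected (with_proj ?H)"
    by (rule connected_relabel_if_reaches_root [OF pair_graph_limb_tree inj_to_nat, of Hub])
      (simp_all add: pverts_limb_tree reaches_Hub)
  show "secure_domination_number ?H = a"
    using assms(1) by (simp add: secure_domination_number_relabel)
  show "secure_domination_number (mycielskian ?H) = b"
    using assms(2) by (simp add: secure_domination_number_mycielskian_relabel)
qed

end

text \<open>
  The parts of the counting arguments are fibres: the core is the fibre over \<open>0\<close> and the \<open>j\<close>-th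
  pendant edge belongs to the fibre over \<open>Suc j\<close>. In the Mycielskian the original vertex and its
  copy lie in the same part, and the apex is counted with the hub.
\<close>

primrec original :: "node myc_vertex \<Rightarrow> node" where
  "original (Orig v) = v"
| "original (Copy v) = v"
| "original Apex = Hub"

primrec leg :: "node \<Rightarrow> nat" where
  "leg Hub = 0"
| "leg (Spoke i) = 0"
| "leg (Knee j) = Suc j"
| "leg (Foot j) = Suc j"

text \<open>
  A partition in which the \<open>i\<close>-th spoke is counted together with the \<open>i\<close>-th pendant edge. It is used
  for the trees in which that edge hangs at that spoke.
\<close>

primrec long_leg :: "node \<Rightarrow> nat" where
  "long_leg Hub = 0"
| "long_leg (Spoke i) = Suc i"
| "long_leg (Knee j) = Suc j"
| "long_leg (Foot j) = Suc j"

lemma card_core_plus_legs_le: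
  fixes f :: "'a \<Rightarrow> nat"
  assumes "finite S"
  shows "card {v \<in> S. f v = 0} + (\<Sum>j<m. card {v \<in> S. f v = Suc j}) \<le> card S"
  using sum_card_fibres_le [OF assms, of "{..<Suc m}" f]
  by (simp only: finite_lessThan sum.lessThan_Suc_shift)

lemma card_core_plus_legs_ge:
  fixes f :: "'a \<Rightarrow> nat"
  assumes "finite S" and "k \<le> card {v \<in> S. f v = 0}"
    and "\<And>j. j < m \<Longrightarrow> \<exists>v\<in>S. f v = Suc j"
  shows "k + m \<le> card S"
proof -
  have "1 \<le> card {v \<in> S. f v = Suc j}" if "j < m" for j
    using assms(3)[OF that] assms(1) by (auto simp: Suc_le_eq card_gt_0_iff)
  then have "(\<Sum>j<m. 1) \<le> (\<Sum>j<m. card {v \<in> S. f v = Suc j})"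
    by (intro sum_mono) auto
  with assms(2) card_core_plus_legs_le [OF assms(1), of f m] show ?thesis
    by simp
qed

text \<open>
  Reduces a bound on the number of guards among a few named vertices to propositional reasoning
  about which of them are guards.
\<close>

lemma card_ge_sum_of_bool:
  assumes "finite A" and "finite B"
  shows "(\<Sum>x\<in>B. of_bool (x \<in> A)) \<le> card A"
proof -
  have "(\<Sum>x\<in>B. of_bool (x \<in> A)) = card (B \<inter> A)"
    using assms(2) by (simp add: Int_def)
  then show ?thesis
    using assms(1) by (simp add: card_mono)
qed

context limb_tree_graph
begin

lemma dominated_Foot:
  assumes "dominating_set G S" and "j < m"
  shows "Foot j \<in> S \<or> Knee j \<in> S"
  using dominating_setE [OF assms(1), of "Foot j"] assms(2)
  by (auto simp: pverts_limb_tree neighbours)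

text \<open>
  A knee, a foot and their copies see nothing outside their own leg except the point of attachment,
  its copy and the apex. The lower bounds apply these disjunctions to the guards before and after a swap.
\<close>

lemma dominated_mycielskian:
  assumes "dominating_set (mycielskian G) S"
  shows "j < m \<Longrightarrow> Orig (Foot j) \<in> S \<or> Orig (Knee j) \<in> S \<or> Copy (Knee j) \<in> S"
    and "j < m \<Longrightarrow> Copy (Foot j) \<in> S \<or> Orig (Knee j) \<in> S \<or> Apex \<in> S"
    and "j < m \<Longrightarrow> Orig (Knee j) \<in> S \<or> Orig (Foot j) \<in> S \<or> Copy (Foot j) \<in> S
      \<or> Orig (par j) \<in> S \<or> Copy (par j) \<in> S"
    and "j < m \<Longrightarrow> Copy (Knee j) \<in> S \<or> Orig (Foot j) \<in> S \<or> Orig (par j) \<in> S \<or> Apex \<in> S"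
  using assms dominating_setE [OF assms, of "Orig (Foot j)"]
    dominating_setE [OF assms, of "Copy (Foot j)"]
    dominating_setE [OF assms, of "Orig (Knee j)"]
    dominating_setE [OF assms, of "Copy (Knee j)"]
  by (auto simp: pverts_mycielskian pverts_limb_tree neighbours_mycielskian neighbours)

end

section \<open>Pendant edges at the hub\<close>

text \<open>
  With a single leaf and at least one knee, the hub and the apex would defend the core of the
  Mycielskian by themselves: whichever of them steps onto the leaf or its copy leaves nothing
  undominated. A second leaf prevents this.
\<close>

locale short_limbs = limb_tree_graph q m "\<lambda>_. Hub" for q m :: nat +
  assumes two_spokes: "2 \<le> q"
begin

lemma secure_dominating_set_base:
  "secure_dominating_set G (insert Hub (Spoke ` {1..<q} \<union> Knee ` {..<m}))"
proof -
  let ?S = "insert Hub (Spoke ` {1..<q} \<union> Knee ` {..<m})"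
  have "\<exists>v\<in>?S. (u, v) \<in> parcs G \<and> dominating_set G (?S - {v} \<union> {u})"
    if u: "u \<in> pverts G - ?S" for u
  proof -
    consider "u = Spoke 0" | j where "u = Foot j" "j < m"
      using u by (force simp: pverts_limb_tree)
    then show ?thesis
    proof cases
      case 1
      have "dominating_set G (?S - {Hub} \<union> {u})"
        unfolding dominating_set_def using 1 two_spokes
        by (auto simp: pverts_limb_tree neighbours)
      with 1 two_spokes show ?thesis
        by (intro bexI [of _ Hub]) (auto simp: neighbours)
    next
      case 2
      have "dominating_set G (?S - {Knee j} \<union> {u})"
        unfolding dominating_set_def using 2 two_spokes
        by (auto simp: pverts_limb_tree neighbours)
      with 2 show ?thesis
        by (intro bexI [of _ "Knee j"]) (auto simp: neighbours)
    qed
  qed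
  moreover have "dominating_set G ?S"
    unfolding dominating_set_def using two_spokes
    by (auto simp: pverts_limb_tree neighbours)
  ultimately show ?thesis
    by (simp add: secure_dominating_set_def)
qed

text \<open>
  At most one spoke can be unguarded: an attack on it draws the guard away from the hub, and a
  second unguarded spoke would be left undominated.
\<close>

lemma card_base_ge:
  assumes S: "secure_dominating_set G S"
  shows "q + m \<le> card S"
proof (rule card_core_plus_legs_ge)
  show fin: "finite S"
    using S by (rule finite_secure_dominating_set)
  have dom: "dominating_set G S"
    using S by (simp add: secure_dominating_set_def)
  show "\<exists>v\<in>S. leg v = Suc j" if "j < m" for j
    using dominated_Foot [OF dom that] by force
  let ?C = "{v \<in> S. leg v = 0}"
  have "\<exists>B\<subseteq>?C. card B = q"
  proof (cases "\<exists>i<q. Spoke i \<notin> S")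
    case False
    then show ?thesis
      by (intro exI [of _ "Spoke ` {..<q}"]) (auto simp: card_image inj_on_def)
  next
    case True
    then obtain i where i: "i < q" "Spoke i \<notin> S"
      by blast
    then obtain v where v: "v \<in> S" "(Spoke i, v) \<in> parcs G"
      and swap: "dominating_set G (insert (Spoke i) (S - {v}))"
      using S by (auto simp: pverts_limb_tree elim!: secure_dominating_setE [where u = "Spoke i"])
    have "v = Hub"
      using v(2) by (auto simp: neighbours)
    have "Spoke k \<in> S" if "k < q" "k \<noteq> i" for k
      using dominating_setE [OF swap, of "Spoke k"] that \<open>v = Hub\<close>
      by (auto simp: pverts_limb_tree neighbours)
    moreover have "card (insert Hub (Spoke ` ({..<q} - {i}))) = q"
      using i by (subst card_insert_disjoint) (auto simp: card_image inj_on_def)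
    ultimately show ?thesis
      using v(1) \<open>v = Hub\<close> by (intro exI [of _ "insert Hub (Spoke ` ({..<q} - {i}))"]) auto
  qed
  with fin show "q \<le> card ?C"
    by (auto intro: card_mono)
qed

lemma secure_domination_number_base: "secure_domination_number G = q + m"
proof (rule secure_domination_number_eqI [OF secure_dominating_set_base])
  have "card (Spoke ` {1..<q} \<union> Knee ` {..<m}) = q - 1 + m"
    by (subst card_Un_disjoint) (auto simp: card_image inj_on_def)
  then show "card (insert Hub (Spoke ` {1..<q} \<union> Knee ` {..<m})) = q + m"
    using two_spokes by (subst card_insert_disjoint) auto
qed (rule card_base_ge)

lemma secure_dominating_set_mycielskian:
  "secure_dominating_set (mycielskian G)
     (insert Apex (Orig ` insert Hub (Knee ` {..<m}) \<union> Copy ` {Hub}))"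
proof (rule secure_dominating_set_mycielskianI)
  show "dominating_set G (insert Hub (Knee ` {..<m}))"
    by (auto simp: dominating_set_def pverts_limb_tree neighbours)
  show "\<exists>v\<in>insert Hub (Knee ` {..<m}). (u, v) \<in> parcs G" if "u \<in> pverts G - {Hub}" for u
    using that by (auto simp: pverts_limb_tree neighbours)
  fix u assume "u \<in> pverts G - insert Hub (Knee ` {..<m})"
  then consider i where "u = Spoke i" "i < q" | j where "u = Foot j" "j < m"
    by (auto simp: pverts_limb_tree)
  then show "(\<exists>v\<in>insert Hub (Knee ` {..<m}). (u, v) \<in> parcs G \<and>
      dominating_set G (insert u (insert Hub (Knee ` {..<m}) - {v}))) \<or> (\<exists>v\<in>{Hub}. (u, v) \<in> parcs G)"
  proof cases
    case 1
    then show ?thesis by (auto simp: neighbours)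
  next
    case 2
    then have "dominating_set G (insert u (insert Hub (Knee ` {..<m}) - {Knee j}))"
      unfolding dominating_set_def by (auto simp: pverts_limb_tree neighbours)
    with 2 show ?thesis
      by (intro disjI1 bexI [of _ "Knee j"]) (auto simp: neighbours)
  qed
qed (auto simp: pverts_limb_tree)

lemma dominated_Spoke_mycielskian:
  assumes "dominating_set (mycielskian G) S" and "i < q"
  shows "Orig (Spoke i) \<in> S \<or> Orig Hub \<in> S \<or> Copy Hub \<in> S"
    and "Copy (Spoke i) \<in> S \<or> Orig Hub \<in> S \<or> Apex \<in> S"
  using dominating_setE [OF assms(1), of "Orig (Spoke i)"]
    dominating_setE [OF assms(1), of "Copy (Spoke i)"] assms(2)
  by (auto simp: pverts_mycielskian pverts_limb_tree neighbours_mycielskian neighbours)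

text \<open>
  The core needs three guards. A leaf sees only the hub and its copy, and the copy of a leaf only
  the hub and the apex. Without the hub, two guards can dominate two leaves and their copies only
  from the copy of the hub and the apex, and an attack on one leaf then exposes the other. With the
  hub and one other guard, an attack on an unguarded leaf cannot be met by the hub, because the
  other guard cannot dominate both the second leaf and the copies; so that guard stands on the copy
  of the hub. Then an attack on the copy of a leaf draws the hub away and exposes the copy of the
  other leaf.
\<close>

lemma card_mycielskian_ge:
  assumes S: "secure_dominating_set (mycielskian G) S"
  shows "3 + m \<le> card S"
proof (rule card_core_plus_legs_ge)
  show fin: "finite S"
    using S by (rule finite_secure_dominating_set)
  have dom: "dominating_set (mycielskian G) S"
    using S by (simp add: secure_dominating_set_def)
  show "\<exists>v\<in>S. (leg \<circ> original) v = Suc j" if "j < m" for j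
    using dominated_mycielskian(1) [OF dom that] by force
  let ?C = "{v \<in> S. (leg \<circ> original) v = 0}"
  have lt: "0 < q" "1 < q"
    using two_spokes by auto
  note at0 = dominated_Spoke_mycielskian [OF _ lt(1)]
  note at1 = dominated_Spoke_mycielskian [OF _ lt(2)]
  have spoke0: "Orig Hub \<in> S \<and> (Orig (Spoke 1) \<in> S \<or> Copy Hub \<in> S) \<and>
        (Copy (Spoke 0) \<in> S \<or> Apex \<in> S) \<and> (Copy (Spoke 1) \<in> S \<or> Apex \<in> S) \<or>
      Copy Hub \<in> S \<and> (Orig (Spoke 1) \<in> S \<or> Orig Hub \<in> S)"
    if notin: "Orig (Spoke 0) \<notin> S"
  proof -
    obtain v where v: "v \<in> S" "(Orig (Spoke 0), v) \<in> parcs (mycielskian G)"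
      and swap: "dominating_set (mycielskian G) (insert (Orig (Spoke 0)) (S - {v}))"
      using notin lt
      by (auto simp: pverts_mycielskian pverts_limb_tree
          intro: secure_dominating_setE [OF S, of "Orig (Spoke 0)"])
    show ?thesis
      using v at0 [OF swap] at1 [OF swap] by (auto simp: neighbours_mycielskian neighbours)
  qed
  have spoke0': "Orig Hub \<in> S \<and> (Copy (Spoke 1) \<in> S \<or> Apex \<in> S) \<or> Apex \<in> S"
    if notin: "Copy (Spoke 0) \<notin> S"
  proof -
    obtain v where v: "v \<in> S" "(Copy (Spoke 0), v) \<in> parcs (mycielskian G)"
      and swap: "dominating_set (mycielskian G) (insert (Copy (Spoke 0)) (S - {v}))"
      using notin lt
      by (auto simp: pverts_mycielskian pverts_limb_tree
          intro: secure_dominating_setE [OF S, of "Copy (Spoke 0)"])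
    show ?thesis
      using v at0 [OF swap] at1 [OF swap] by (auto simp: neighbours_mycielskian neighbours)
  qed
  have "3 \<le> (\<Sum>x\<in>{Orig Hub, Copy Hub, Apex, Orig (Spoke 0), Orig (Spoke 1),
      Copy (Spoke 0), Copy (Spoke 1)}. of_bool (x \<in> ?C) :: nat)"
    using at0 [OF dom] at1 [OF dom] spoke0 spoke0' by (auto simp: of_bool_def split: if_splits)
  also have "\<dots> \<le> card ?C"
    using fin by (intro card_ge_sum_of_bool) auto
  finally show "3 \<le> card ?C" .
qed

lemma secure_domination_number_mycielskian:
  "secure_domination_number (mycielskian G) = 3 + m"
proof (rule secure_domination_number_eqI [OF secure_dominating_set_mycielskian])
  have "card (insert Hub (Knee ` {..<m})) = m + 1"
    by (subst card_insert_disjoint) (auto simp: card_image inj_on_def)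
  then show "card (insert Apex (Orig ` insert Hub (Knee ` {..<m}) \<union> Copy ` {Hub})) = 3 + m"
    by (subst card_insert_Apex) auto
qed (rule card_mycielskian_ge)

end

section \<open>Pendant edges below the spokes\<close>

text \<open>
  The first \<open>q\<close> knees are attached to different spokes, so that \<open>Spoke i\<close> carries \<open>Knee i\<close>. All
  other knees are attached to \<open>Spoke 0\<close>.
\<close>

locale long_limbs = limb_tree_graph q m "\<lambda>j. Spoke (if j < q then j else 0)" for q m :: nat +
  assumes spokes: "0 < q" "q \<le> m"
begin

lemma Spoke_Knee_arc:
  "i < q \<Longrightarrow> (Spoke i, Knee i) \<in> parcs G"
  using spokes by (auto simp: neighbours)

lemma secure_dominating_set_base:
  "secure_dominating_set G (insert Hub (Knee ` {..<m}))"
proof -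
  let ?S = "insert Hub (Knee ` {..<m})"
  have "\<exists>v\<in>?S. (u, v) \<in> parcs G \<and> dominating_set G (?S - {v} \<union> {u})"
    if u: "u \<in> pverts G - ?S" for u
  proof -
    consider i where "u = Spoke i" "i < q" | j where "u = Foot j" "j < m"
      using u by (auto simp: pverts_limb_tree)
    then show ?thesis
    proof cases
      case 1
      have "dominating_set G (?S - {Hub} \<union> {u})"
        unfolding dominating_set_def
      proof (intro conjI ballI)
        fix x assume "x \<in> pverts G - (?S - {Hub} \<union> {u})"
        then consider "x = Hub" | k where "x = Spoke k" "k < q" | j where "x = Foot j" "j < m"
          by (auto simp: pverts_limb_tree)
        then show "\<exists>v\<in>?S - {Hub} \<union> {u}. (x, v) \<in> parcs G"
        proof cases
          case 2
          with spokes show ?thesis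
            by (intro bexI [of _ "Knee k"]) (auto simp: Spoke_Knee_arc)
        qed (use 1 in \<open>auto simp: neighbours\<close>)
      qed (use 1 in \<open>auto simp: pverts_limb_tree\<close>)
      with 1 show ?thesis
        by (intro bexI [of _ Hub]) (auto simp: neighbours)
    next
      case 2
      have "dominating_set G (?S - {Knee j} \<union> {u})"
        unfolding dominating_set_def using 2
        by (auto simp: pverts_limb_tree neighbours)
      with 2 show ?thesis
        by (intro bexI [of _ "Knee j"]) (auto simp: neighbours)
    qed
  qed
  moreover have "dominating_set G ?S"
    unfolding dominating_set_def by (auto simp: pverts_limb_tree neighbours)
  ultimately show ?thesis
    by (simp add: secure_dominating_set_def)
qed

text \<open>
  Domination alone suffices here: the closed neighbourhoods of the hub and of the feet are pairwise
  disjoint.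
\<close>

lemma card_base_ge:
  assumes S: "secure_dominating_set G S"
  shows "1 + m \<le> card S"
proof (rule card_core_plus_legs_ge)
  show fin: "finite S"
    using S by (rule finite_secure_dominating_set)
  have dom: "dominating_set G S"
    using S by (simp add: secure_dominating_set_def)
  show "\<exists>v\<in>S. leg v = Suc j" if "j < m" for j
    using dominated_Foot [OF dom that] by force
  have "\<exists>v\<in>S. leg v = 0"
    by (rule dominating_setE [OF dom, of Hub]) (force simp: pverts_limb_tree neighbours)+
  with fin show "1 \<le> card {v \<in> S. leg v = 0}"
    by (auto simp: Suc_le_eq card_gt_0_iff)
qed

lemma secure_domination_number_base: "secure_domination_number G = 1 + m"
proof (rule secure_domination_number_eqI [OF secure_dominating_set_base])
  show "card (insert Hub (Knee ` {..<m})) = 1 + m"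
    by (subst card_insert_disjoint) (auto simp: card_image inj_on_def)
qed (rule card_base_ge)

text \<open>
  Spokes and knees together dominate totally, since every spoke bears a knee. The hub is defended
  by a spoke, whose other neighbours are guarded knees, and each foot by its knee, whose own
  domination is then taken over by the foot.
\<close>

lemma secure_dominating_set_mycielskian:
  "secure_dominating_set (mycielskian G)
     (insert Apex (Orig ` (Spoke ` {..<q} \<union> Knee ` {..<m}) \<union> Copy ` {}))"
proof (rule secure_dominating_set_mycielskianI)
  let ?D = "Spoke ` {..<q} \<union> Knee ` {..<m}"
  show total: "\<exists>v\<in>?D. (u, v) \<in> parcs G" if u: "u \<in> pverts G - {}" for u
  proof -
    consider "u = Hub" | i where "u = Spoke i" "i < q" | j where "u = Knee j" "j < m"
      | j where "u = Foot j" "j < m"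
      using u by (auto simp: pverts_limb_tree)
    then show ?thesis
    proof cases
      case 1
      with spokes show ?thesis
        by (intro bexI [of _ "Spoke 0"]) (auto simp: neighbours)
    next
      case 2
      with spokes show ?thesis
        by (intro bexI [of _ "Knee i"]) (auto simp: Spoke_Knee_arc)
    qed (use spokes in \<open>auto simp: neighbours\<close>)
  qed
  then show dom: "dominating_set G ?D"
    using spokes by (auto simp: dominating_set_def pverts_limb_tree)
  fix u assume "u \<in> pverts G - ?D"
  then consider "u = Hub" | j where "u = Foot j" "j < m"
    by (auto simp: pverts_limb_tree)
  then have "\<exists>v\<in>?D. (u, v) \<in> parcs G \<and> dominating_set G (insert u (?D - {v}))"
  proof cases
    case 1
    then have "dominating_set G (insert u (?D - {Spoke 0}))"
      unfolding dominating_set_def using spokes by (auto simp: pverts_limb_tree neighbours)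
    with 1 spokes show ?thesis
      by (intro bexI [of _ "Spoke 0"]) (auto simp: neighbours)
  next
    case 2
    have "dominating_set G (insert u (?D - {Knee j}))"
      unfolding dominating_set_def
    proof (intro conjI ballI)
      fix x assume "x \<in> pverts G - insert u (?D - {Knee j})"
      then consider "x = Hub" | "x = Knee j" | k where "x = Foot k" "k < m" "k \<noteq> j"
        using 2 by (auto simp: pverts_limb_tree)
      then show "\<exists>v\<in>insert u (?D - {Knee j}). (x, v) \<in> parcs G"
      proof cases
        case 1
        with spokes show ?thesis
          by (intro bexI [of _ "Spoke 0"]) (auto simp: neighbours)
      qed (use 2 in \<open>auto simp: neighbours\<close>)
    qed (use 2 spokes in \<open>auto simp: pverts_limb_tree\<close>)
    with 2 show ?thesis
      by (intro bexI [of _ "Knee j"]) (auto simp: neighbours)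
  qed
  then show "(\<exists>v\<in>?D. (u, v) \<in> parcs G \<and> dominating_set G (insert u (?D - {v}))) \<or>
      (\<exists>v\<in>{}. (u, v) \<in> parcs G)"
    by blast
qed (auto simp: pverts_limb_tree)

text \<open>
  The copy of a foot can be defended only by the knee or by the apex. If the knee moves, the foot
  has to be dominated otherwise; if the apex moves, the copy of the knee has to be.
\<close>

lemma swap_Copy_Foot_mycielskian:
  assumes S: "secure_dominating_set (mycielskian G) S" and j: "j < m"
    and notin: "Copy (Foot j) \<notin> S"
  shows "Orig (Knee j) \<in> S \<and> (Orig (Foot j) \<in> S \<or> Copy (Knee j) \<in> S) \<or>
    Apex \<in> S \<and> (Copy (Knee j) \<in> S \<or> Orig (Foot j) \<in> S \<or> Orig (Spoke (if j < q then j else 0)) \<in> S)"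
proof -
  obtain v where v: "v \<in> S" "(Copy (Foot j), v) \<in> parcs (mycielskian G)"
    and swap: "dominating_set (mycielskian G) (insert (Copy (Foot j)) (S - {v}))"
    using notin j
    by (auto simp: pverts_mycielskian pverts_limb_tree
        intro: secure_dominating_setE [OF S, of "Copy (Foot j)"])
  show ?thesis
    using v dominated_mycielskian [OF swap j] by (auto simp: neighbours_mycielskian neighbours)
qed

lemma swap_Copy_Knee_mycielskian:
  assumes S: "secure_dominating_set (mycielskian G) S" and j: "j < m" "j < q"
    and notin: "Copy (Knee j) \<notin> S"
  shows "Apex \<in> S \<and> (Orig (Knee j) \<in> S \<or> Copy (Foot j) \<in> S) \<or>
    Orig (Foot j) \<in> S \<and> (Orig (Knee j) \<in> S \<or> Copy (Foot j) \<in> S \<or> Orig (Spoke j) \<in> S \<or> Copy (Spoke j) \<in> S) \<or>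
    Orig (Spoke j) \<in> S"
proof -
  obtain v where v: "v \<in> S" "(Copy (Knee j), v) \<in> parcs (mycielskian G)"
    and swap: "dominating_set (mycielskian G) (insert (Copy (Knee j)) (S - {v}))"
    using notin j
    by (auto simp: pverts_mycielskian pverts_limb_tree
        intro: secure_dominating_setE [OF S, of "Copy (Knee j)"])
  show ?thesis
    using v dominated_mycielskian [OF swap j(1)] j
    by (auto simp: neighbours_mycielskian neighbours)
qed

text \<open>
  A lone guard of a leg must dominate the foot, so it stands on the foot, the knee or the copy of
  the knee. On the copy of the knee it leaves the knee undominated. On the knee it cannot cope with
  an attack on the copy of the foot: either it moves and the foot is lost, or the apex moves and
  the copy of the knee is lost. On the foot it cannot cope with an attack on the copy of the knee,
  since the apex would expose the copy of the foot, and the foot would expose the knee.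

  If the apex is unguarded and the spoke or its copy is guarded, two further guards are needed. The
  copy of the foot is a guard or is defended by the knee, and in either case another guard has to
  watch the foot.
\<close>

lemma card_leg_ge:
  assumes S: "secure_dominating_set (mycielskian G) S" and j: "j < q"
  shows "2 \<le> card {v \<in> S. (long_leg \<circ> original) v = Suc j}"
    and "Apex \<notin> S \<Longrightarrow> Orig (Spoke j) \<in> S \<or> Copy (Spoke j) \<in> S \<Longrightarrow>
      3 \<le> card {v \<in> S. (long_leg \<circ> original) v = Suc j}"
proof -
  let ?C = "{v \<in> S. (long_leg \<circ> original) v = Suc j}"
  let ?B = "{Orig (Spoke j), Copy (Spoke j), Orig (Knee j), Copy (Knee j),
      Orig (Foot j), Copy (Foot j)}"
  have m: "j < m"
    using j spokes by simp
  have dom: "dominating_set (mycielskian G) S"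
    using S by (simp add: secure_dominating_set_def)
  have fin: "finite ?C"
    using finite_secure_dominating_set(2) [OF S] by simp
  note facts = dominated_mycielskian [OF dom m] swap_Copy_Foot_mycielskian [OF S m]
    swap_Copy_Knee_mycielskian [OF S m j]
  have "2 \<le> (\<Sum>x\<in>?B. of_bool (x \<in> ?C) :: nat)"
    using facts j by (auto simp: of_bool_def split: if_splits)
  also have "\<dots> \<le> card ?C"
    using fin by (intro card_ge_sum_of_bool) auto
  finally show "2 \<le> card ?C" .
  assume "Apex \<notin> S" "Orig (Spoke j) \<in> S \<or> Copy (Spoke j) \<in> S"
  then have "3 \<le> (\<Sum>x\<in>?B. of_bool (x \<in> ?C) :: nat)"
    using facts j by (auto simp: of_bool_def split: if_splits)
  also have "\<dots> \<le> card ?C"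
    using fin by (intro card_ge_sum_of_bool) auto
  finally show "3 \<le> card ?C" .
qed

text \<open>
  The legs account for \<open>q + m\<close> guards. One more is found in the core or, if the core is unguarded, at the
  spoke that dominates the hub: without the apex, its leg has at least three guards.
\<close>

lemma card_mycielskian_ge:
  assumes S: "secure_dominating_set (mycielskian G) S"
  shows "1 + q + m \<le> card S"
proof -
  define c where "c k = card {v \<in> S. (long_leg \<circ> original) v = k}" for k
  \<comment> \<open>the number of guards that are forced on each leg\<close>
  define w :: "nat \<Rightarrow> nat" where "w j = (if j < q then 2 else 1)" for j
  have dom: "dominating_set (mycielskian G) S"
    using S by (simp add: secure_dominating_set_def)
  have fin: "finite S"
    using S by (rule finite_secure_dominating_set)
  have c_pos: "1 \<le> c k" if "v \<in> S" "long_leg (original v) = k" for k v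
    using that fin by (auto simp: c_def Suc_le_eq card_gt_0_iff)
  have w_le: "w j \<le> c (Suc j)" if "j < m" for j
  proof (cases "j < q")
    case True
    then show ?thesis
      using card_leg_ge(1) [OF S] by (simp add: w_def c_def)
  next
    case False
    have "1 \<le> c (Suc j)"
      using dominated_mycielskian(1) [OF dom that] by (elim disjE) (rule c_pos, assumption, simp)+
    with False show ?thesis by (simp add: w_def)
  qed
  have sum_w: "(\<Sum>j<m. w j) = q + m"
  proof -
    have "(\<Sum>j<m. w j) = (\<Sum>j<m. of_bool (j < q)) + (\<Sum>j<m. 1)"
      unfolding sum.distrib [symmetric]
      by (rule sum.cong) (auto simp: w_def)
    also have "\<dots> = card ({..<m} \<inter> {j. j < q}) + m"
      by simp
    also have "{..<m} \<inter> {j. j < q} = {..<q}"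
      using spokes by auto
    finally show ?thesis by simp
  qed
  have "1 + (\<Sum>j<m. w j) \<le> c 0 + (\<Sum>j<m. c (Suc j))"
  proof (cases "Apex \<in> S \<or> Orig Hub \<in> S \<or> Copy Hub \<in> S")
    case True
    then have "1 \<le> c 0"
      by (elim disjE) (rule c_pos, assumption, simp)+
    then show ?thesis
      using w_le by (intro add_mono sum_mono) auto
  next
    case False
    then obtain i where i: "i < q" "Orig (Spoke i) \<in> S \<or> Copy (Spoke i) \<in> S"
      using dominating_setE [OF dom, of "Orig Hub"]
      by (auto simp: pverts_mycielskian pverts_limb_tree neighbours_mycielskian neighbours)
    then have "w i < c (Suc i)"
      using card_leg_ge(2) [OF S] False by (fastforce simp: w_def c_def)
    then have "(\<Sum>j<m. w j) < (\<Sum>j<m. c (Suc j))"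
      using w_le i spokes by (intro sum_strict_mono_ex1) (auto intro!: bexI [of _ i])
    then show ?thesis by simp
  qed
  also have "\<dots> \<le> card S"
    unfolding c_def using fin by (rule card_core_plus_legs_le)
  finally show ?thesis
    by (simp add: sum_w)
qed

lemma secure_domination_number_mycielskian:
  "secure_domination_number (mycielskian G) = 1 + q + m"
proof (rule secure_domination_number_eqI [OF secure_dominating_set_mycielskian])
  have "card (Spoke ` {..<q} \<union> Knee ` {..<m}) = q + m"
    by (subst card_Un_disjoint) (auto simp: card_image inj_on_def)
  then show "card (insert Apex (Orig ` (Spoke ` {..<q} \<union> Knee ` {..<m}) \<union> Copy ` {})) = 1 + q + m"
    by (subst card_insert_Apex) auto
qed (rule card_mycielskian_ge)

end

section \<open>All pairs of secure domination numbers\<close>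

theorem theorem4p1:
  fixes a b :: nat
  assumes "a \<ge> 2" and "3 \<le> b" and "b \<le> 2 * a - 1"
  shows "\<exists>G :: nat pair_pre_digraph.
           pair_graph G \<and> connected (with_proj G) \<and>
           secure_domination_number G = a \<and>
           secure_domination_number (mycielskian G) = b"
proof (cases "b \<le> a + 1")
  case True
  interpret short_limbs "a + 3 - b" "b - 3"
    by unfold_locales (use True in auto)
  show ?thesis
    by (rule nat_copy)
      (use assms True in \<open>simp_all add: secure_domination_number_base
        secure_domination_number_mycielskian\<close>)
next
  case False
  interpret long_limbs "b - a" "a - 1"
    by unfold_locales (use assms False in auto)
  show ?thesis
    using secure_domination_number_base secure_domination_number_mycielskian assms False
    by (intro nat_copy) linarith+
qed

end
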